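(* Let $(M,\mathrm{acc},\mathrm{rej})$ be a monitoring system that is maximal for the collection of all properties. For every property $P\subseteq\mathrm{Act}^\infty$: (i) $P$ is EPZ-monitorable if and only if there is a monitor in $M$ that is sound for $P$ and informative; (ii) $P$ is UPZ-monitorable if and only if there is a monitor in $M$ that is sound for $P$ and persistently informative.
   Context: $\mathrm{Act}$ is a finite set of actions, $\mathrm{Act}^\infty=\mathrm{Act}^*\cup\mathrm{Act}^\omega$; a property is a subset of $\mathrm{Act}^\infty$. A finite trace $s$ positively (resp. negatively) determines $P$ if $sf\in P$ (resp. $sf\notin P$) for all $f\in\mathrm{Act}^\infty$. For $s\in\mathrm{Act}^*$, $P$ is $s$-monitorable if there is $t\in\mathrm{Act}^*$ such that $st$ positively or negatively determines $P$. $P$ is UPZ-monitorable if it is $s$-monitorable for all $s\in\mathrm{Act}^*$, and EPZ-monitorable if it is $\varepsilon$-monitorable ($\varepsilon$ the empty trace). A monitoring system is a triple $(M,\mathrm{acc},\mathrm{rej})$ with $M$ nonempty, $\mathrm{acc},\mathrm{rej}\subseteq M\times\mathrm{Act}^\infty$, such that for every $m$: (1) $\mathrm{acc}(m,f)$ implies $\mathrm{acc}(m,s)$ for some finite prefix $s$ of $f$, likewise for $\mathrm{rej}$; (2) $\mathrm{acc}(m,s)$ for finite $s$ implies $\mathrm{acc}(m,sf)$ for all $f$, likewise for $\mathrm{rej}$. It is maximal for a collection $C$ if for every $P\in C$ there is $m_P\in M$ with $\mathrm{acc}(m_P,f)$ iff $f$ has a finite prefix positively determining $P$, and $\mathrm{rej}(m_P,f)$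 iff $f$ has a finite prefix negatively determining $P$. $m$ is sound for $P$ if $\mathrm{acc}(m,f)\Rightarrow f\in P$ and $\mathrm{rej}(m,f)\Rightarrow f\notin P$. $m$ is informative if $\mathrm{acc}(m,f)$ or $\mathrm{rej}(m,f)$ for some $f$; persistently informative if for every $s\in\mathrm{Act}^*$ there is $f\in\mathrm{Act}^\infty$ with $\mathrm{acc}(m,sf)$ or $\mathrm{rej}(m,sf)$. *)

theory Defs
  imports "HOL-Library.Stream"
begin

text \<open>Finite and infinite words; the alphabet is a carrier set, so it may also be empty.\<close>

datatype 'a trace = Fin "'a list" | Inf "'a stream"

definition traces :: "'a set \<Rightarrow> 'a trace set" where
  "traces Act = Fin ` lists Act \<union> Inf ` streams Act"

fun cat :: "'a list \<Rightarrow> 'a trace \<Rightarrow> 'a trace"  (infixr "\<frown>" 65) where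
  "s \<frown> Fin t = Fin (s @ t)"
| "s \<frown> Inf w = Inf (s @- w)"

definition fin_prefix :: "'a list \<Rightarrow> 'a trace \<Rightarrow> bool" where
  "fin_prefix s f \<longleftrightarrow> (\<exists>g. f = s \<frown> g)"

definition pos_determines :: "'a set \<Rightarrow> 'a list \<Rightarrow> 'a trace set \<Rightarrow> bool" where
  "pos_determines Act s P \<longleftrightarrow> (\<forall>f \<in> traces Act. s \<frown> f \<in> P)"

definition neg_determines :: "'a set \<Rightarrow> 'a list \<Rightarrow> 'a trace set \<Rightarrow> bool" where
  "neg_determines Act s P \<longleftrightarrow> (\<forall>f \<in> traces Act. s \<frown> f \<notin> P)"

definition monitorable_at :: "'a set \<Rightarrow> 'a list \<Rightarrow> 'a trace set \<Rightarrow> bool" where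
  "monitorable_at Act s P \<longleftrightarrow>
    (\<exists>t \<in> lists Act. pos_determines Act (s @ t) P \<or> neg_determines Act (s @ t) P)"

definition UPZ_monitorable :: "'a set \<Rightarrow> 'a trace set \<Rightarrow> bool" where
  "UPZ_monitorable Act P \<longleftrightarrow> (\<forall>s \<in> lists Act. monitorable_at Act s P)"

definition EPZ_monitorable :: "'a set \<Rightarrow> 'a trace set \<Rightarrow> bool" where
  "EPZ_monitorable Act P \<longleftrightarrow> monitorable_at Act [] P"

definition monitoring_system ::
  "'a set \<Rightarrow> 'm set \<Rightarrow> ('m \<times> 'a trace) set \<Rightarrow> ('m \<times> 'a trace) set \<Rightarrow> bool" where
  "monitoring_system Act M acc rej \<longleftrightarrow>
    M \<noteq> {} \<and> acc \<subseteq> M \<times> traces Act \<and> rej \<subseteq> M \<times> traces Act \<and>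
    (\<forall>m \<in> M.
      (\<forall>f \<in> traces Act. (m, f) \<in> acc \<longrightarrow>
        (\<exists>s \<in> lists Act. fin_prefix s f \<and> (m, Fin s) \<in> acc)) \<and>
      (\<forall>f \<in> traces Act. (m, f) \<in> rej \<longrightarrow>
        (\<exists>s \<in> lists Act. fin_prefix s f \<and> (m, Fin s) \<in> rej)) \<and>
      (\<forall>s \<in> lists Act. (m, Fin s) \<in> acc \<longrightarrow> (\<forall>f \<in> traces Act. (m, s \<frown> f) \<in> acc)) \<and>
      (\<forall>s \<in> lists Act. (m, Fin s) \<in> rej \<longrightarrow> (\<forall>f \<in> traces Act. (m, s \<frown> f) \<in> rej)))"

definition maximal_for ::
  "'a set \<Rightarrow> 'm set \<Rightarrow> ('m \<times> 'a trace) set \<Rightarrow> ('m \<times> 'a trace) set \<Rightarrow> 'a trace set set \<Rightarrow> bool" where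
  "maximal_for Act M acc rej C \<longleftrightarrow>
    (\<forall>P \<in> C. \<exists>m \<in> M. \<forall>f \<in> traces Act.
      ((m, f) \<in> acc \<longleftrightarrow> (\<exists>s \<in> lists Act. fin_prefix s f \<and> pos_determines Act s P)) \<and>
      ((m, f) \<in> rej \<longleftrightarrow> (\<exists>s \<in> lists Act. fin_prefix s f \<and> neg_determines Act s P)))"

definition sound_for ::
  "'a set \<Rightarrow> ('m \<times> 'a trace) set \<Rightarrow> ('m \<times> 'a trace) set \<Rightarrow> 'm \<Rightarrow> 'a trace set \<Rightarrow> bool" where
  "sound_for Act acc rej m P \<longleftrightarrow>
    (\<forall>f \<in> traces Act. ((m, f) \<in> acc \<longrightarrow> f \<in> P) \<and> ((m, f) \<in> rej \<longrightarrow> f \<notin> P))"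

definition informative ::
  "'a set \<Rightarrow> ('m \<times> 'a trace) set \<Rightarrow> ('m \<times> 'a trace) set \<Rightarrow> 'm \<Rightarrow> bool" where
  "informative Act acc rej m \<longleftrightarrow> (\<exists>f \<in> traces Act. (m, f) \<in> acc \<or> (m, f) \<in> rej)"

definition persistently_informative ::
  "'a set \<Rightarrow> ('m \<times> 'a trace) set \<Rightarrow> ('m \<times> 'a trace) set \<Rightarrow> 'm \<Rightarrow> bool" where
  "persistently_informative Act acc rej m \<longleftrightarrow>
    (\<forall>s \<in> lists Act. \<exists>f \<in> traces Act. (m, s \<frown> f) \<in> acc \<or> (m, s \<frown> f) \<in> rej)"

end

theory Submission
  imports Defs
begin

text \<open>The verdicts of a monitor that is sound for \<open>P\<close> on a finite trace are irrevocable, so a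
  verdict on \<open>s \<frown> f\<close>, being reached after finitely many actions, is reached on some \<open>s @ t\<close>
  which then determines \<open>P\<close>. Conversely, maximality provides a sound monitor that reaches
  a verdict as soon as \<open>P\<close> is determined.\<close>

lemma Nil_cat [simp]: "[] \<frown> f = f"
  by (cases f) auto

lemma cat_assoc: "(s @ t) \<frown> f = s \<frown> t \<frown> f"
  by (cases f) auto

lemma streams_shift_iff: "s @- w \<in> streams A \<longleftrightarrow> s \<in> lists A \<and> w \<in> streams A"
  by (induction s) (auto simp: streams_Stream)

lemma cat_in_traces_iff: "s \<frown> f \<in> traces A \<longleftrightarrow> s \<in> lists A \<and> f \<in> traces A"
  by (cases f) (auto simp: traces_def streams_shift_iff image_iff)

lemma Fin_in_traces_iff [simp]: "Fin s \<in> traces A \<longleftrightarrow> s \<in> lists A"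
  by (auto simp: traces_def)

text \<open>Both \<open>s\<close> and \<open>u\<close> are prefixes of one trace, so a long enough
  piece \<open>t\<close> of \<open>f\<close> makes \<open>s @ t\<close> cover \<open>u\<close>,
  whichever of the two is longer.\<close>

lemma fin_prefix_cat_extend:
  assumes "fin_prefix u (s \<frown> f)" and "s \<in> lists A" and "f \<in> traces A"
  obtains t v where "t \<in> lists A" "v \<in> lists A" "s @ t = u @ v"
proof -
  obtain g where g: "s \<frown> f = u \<frown> g"
    using assms(1) by (auto simp: fin_prefix_def)
  have "\<exists>t\<in>lists A. \<exists>v. s @ t = u @ v"
  proof (cases f)
    case (Fin t)
    \<comment> \<open>For finite \<open>f\<close> all of \<open>f\<close> serves as
      \<open>t\<close>; \<open>g\<close> is then finite too and provides \<open>v\<close>.\<close>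
    with g assms(3) show ?thesis
      by (cases g) auto
  next
    case (Inf w)
    with g obtain x where x: "s @- w = u @- x"
      by (cases g) auto
    \<comment> \<open>Cutting the common stream after \<open>length s + length u\<close> letters
      leaves both prefixes intact, so their lengths need not be compared.\<close>
    have "s @ stake (length u) w = stake (length s + length u) (s @- w)"
      by (simp add: stake_shift)
    also have "\<dots> = u @ stake (length s) x"
      by (simp add: x stake_shift)
    finally have "s @ stake (length u) w = u @ stake (length s) x" .
    moreover have "w \<in> streams A"
      using Inf assms(3) by (auto simp: traces_def)
    then have "stake (length u) w \<in> lists A"
      using streams_shift_iff[of "stake (length u) w" "sdrop (length u) w" A]
      by (simp add: stake_sdrop)
    ultimately show ?thesis
      by blast
  qed
  then obtain t v where tv: "t \<in> lists A" "s @ t = u @ v"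
    by blast
  then have "v \<in> lists A"
    using assms(2) by (metis append_in_lists_conv)
  then show thesis
    using that tv by blast
qed

text \<open>\<open>V\<close> abstracts from acceptance and rejection, so one argument covers both:
  the verdict is already reached on a finite prefix \<open>u\<close>, and any \<open>s @ t\<close>
  that extends \<open>u\<close> inherits it together with all its continuations.\<close>

lemma verdict_stable_extension:
  assumes "\<And>f. f \<in> traces A \<Longrightarrow> V f \<Longrightarrow> \<exists>u\<in>lists A. fin_prefix u f \<and> V (Fin u)"
    and "\<And>u f. u \<in> lists A \<Longrightarrow> V (Fin u) \<Longrightarrow> f \<in> traces A \<Longrightarrow> V (u \<frown> f)"
    and "s \<in> lists A" and "f \<in> traces A" and "V (s \<frown> f)"
  shows "\<exists>t\<in>lists A. \<forall>g\<in>traces A. V ((s @ t) \<frown> g)"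
proof -
  obtain u where u: "u \<in> lists A" "fin_prefix u (s \<frown> f)" "V (Fin u)"
    using assms(1)[OF _ assms(5)] assms(3,4) by (auto simp: cat_in_traces_iff)
  obtain t v where tv: "t \<in> lists A" "v \<in> lists A" "s @ t = u @ v"
    using fin_prefix_cat_extend[OF u(2) assms(3,4)] .
  have "V ((s @ t) \<frown> g)" if "g \<in> traces A" for g
    \<comment> \<open>The trace becomes \<open>u \<frown> v \<frown> g\<close>, a continuation of
      \<open>u\<close> by the trace \<open>v \<frown> g\<close>.\<close>
    unfolding tv(3) cat_assoc using assms(2) u tv(2) that by (simp add: cat_in_traces_iff)
  with tv(1) show ?thesis
    by blast
qed

text \<open>Some \<open>s @ t\<close> has the same verdict on all its continuations; soundness turns
  acceptance into positive and rejection into negative determination.\<close>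

lemma monitorable_at_if_verdict:
  assumes sys: "monitoring_system Act M acc rej" and "m \<in> M" and sound: "sound_for Act acc rej m P"
    and s: "s \<in> lists Act" and f: "f \<in> traces Act"
    and "(m, s \<frown> f) \<in> acc \<or> (m, s \<frown> f) \<in> rej"
  shows "monitorable_at Act s P"
  using assms(6)
proof
  assume "(m, s \<frown> f) \<in> acc"
  then have "\<exists>t\<in>lists Act. \<forall>g\<in>traces Act. (m, (s @ t) \<frown> g) \<in> acc"
    using sys \<open>m \<in> M\<close> s f
    by (intro verdict_stable_extension[where V = "\<lambda>f. (m, f) \<in> acc"])
      (auto simp: monitoring_system_def)
  then obtain t where "t \<in> lists Act" "\<forall>g\<in>traces Act. (m, (s @ t) \<frown> g) \<in> acc"
    by blast
  then show ?thesis
    using sound s unfolding monitorable_at_def pos_determines_def sound_for_def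
    by (metis append_in_lists_conv cat_in_traces_iff)
next
  assume "(m, s \<frown> f) \<in> rej"
  then have "\<exists>t\<in>lists Act. \<forall>g\<in>traces Act. (m, (s @ t) \<frown> g) \<in> rej"
    using sys \<open>m \<in> M\<close> s f
    by (intro verdict_stable_extension[where V = "\<lambda>f. (m, f) \<in> rej"])
      (auto simp: monitoring_system_def)
  then obtain t where "t \<in> lists Act" "\<forall>g\<in>traces Act. (m, (s @ t) \<frown> g) \<in> rej"
    by blast
  then show ?thesis
    using sound s unfolding monitorable_at_def neg_determines_def sound_for_def
    by (metis append_in_lists_conv cat_in_traces_iff)
qed

text \<open>The monitor is the one that maximality assigns to \<open>P\<close>. It is sound because
  a determining prefix settles membership in \<open>P\<close>, and if \<open>s @ t\<close>
  determines \<open>P\<close>, its verdict appears on \<open>s \<frown> Fin t\<close>.\<close>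

lemma maximal_forE:
  assumes "maximal_for Act M acc rej C" and "P \<in> C"
  obtains m where "m \<in> M" "sound_for Act acc rej m P"
    "\<And>s. s \<in> lists Act \<Longrightarrow> monitorable_at Act s P \<Longrightarrow>
      \<exists>f\<in>traces Act. (m, s \<frown> f) \<in> acc \<or> (m, s \<frown> f) \<in> rej"
proof -
  obtain m where m: "m \<in> M"
    "\<And>f. f \<in> traces Act \<Longrightarrow>
      (m, f) \<in> acc \<longleftrightarrow> (\<exists>s\<in>lists Act. fin_prefix s f \<and> pos_determines Act s P)"
    "\<And>f. f \<in> traces Act \<Longrightarrow>
      (m, f) \<in> rej \<longleftrightarrow> (\<exists>s\<in>lists Act. fin_prefix s f \<and> neg_determines Act s P)"
    using bspec[OF assms(1)[unfolded maximal_for_def] assms(2)] by blast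
  have "sound_for Act acc rej m P"
    unfolding sound_for_def
  proof (intro ballI)
    fix f
    assume f: "f \<in> traces Act"
    show "((m, f) \<in> acc \<longrightarrow> f \<in> P) \<and> ((m, f) \<in> rej \<longrightarrow> f \<notin> P)"
      \<comment> \<open>The remainder after a prefix in \<open>fin_prefix\<close> ranges over all
        words of the type; \<open>cat_in_traces_iff\<close> puts it back into
        \<open>traces Act\<close>.\<close>
      using f unfolding m(2)[OF f] m(3)[OF f] fin_prefix_def pos_determines_def neg_determines_def
      by (auto simp: cat_in_traces_iff)
  qed
  moreover have "\<exists>f\<in>traces Act. (m, s \<frown> f) \<in> acc \<or> (m, s \<frown> f) \<in> rej"
    if s: "s \<in> lists Act" and mon: "monitorable_at Act s P" for s
  proof -
    obtain t where t: "t \<in> lists Act" "pos_determines Act (s @ t) P \<or> neg_determines Act (s @ t) P"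
      using mon by (auto simp: monitorable_at_def)
    have "fin_prefix (s @ t) (s \<frown> Fin t)"
      unfolding fin_prefix_def by (rule exI[of _ "Fin []"]) simp
    moreover have st: "s @ t \<in> lists Act" "s \<frown> Fin t \<in> traces Act"
      using s t(1) by simp_all
    ultimately have "(m, s \<frown> Fin t) \<in> acc \<or> (m, s \<frown> Fin t) \<in> rej"
      unfolding m(2)[OF st(2)] m(3)[OF st(2)] using t(2) by blast
    with t(1) show ?thesis
      by (intro bexI[of _ "Fin t"]) simp_all
  qed
  ultimately show thesis
    using that m(1) by blast
qed

theorem theorem7:
  fixes Act :: "'a set" and M :: "'m set"
    and acc rej :: "('m \<times> 'a trace) set" and P :: "'a trace set"
  assumes "finite Act"
    and "monitoring_system Act M acc rej"
    and "maximal_for Act M acc rej (Pow (traces Act))"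
    and "P \<subseteq> traces Act"
  shows "(EPZ_monitorable Act P \<longleftrightarrow>
            (\<exists>m \<in> M. sound_for Act acc rej m P \<and> informative Act acc rej m)) \<and>
         (UPZ_monitorable Act P \<longleftrightarrow>
            (\<exists>m \<in> M. sound_for Act acc rej m P \<and> persistently_informative Act acc rej m))"
proof -
  \<comment> \<open>One monitor witnesses both equivalences: its verdicts are used at
    \<open>s = []\<close> for EPZ and at every \<open>s\<close> for UPZ.\<close>
  obtain m where m: "m \<in> M" "sound_for Act acc rej m P"
    "\<And>s. s \<in> lists Act \<Longrightarrow> monitorable_at Act s P \<Longrightarrow>
      \<exists>f\<in>traces Act. (m, s \<frown> f) \<in> acc \<or> (m, s \<frown> f) \<in> rej"
    using maximal_forE[OF assms(3)] assms(4) by (metis PowI)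
  note mon = monitorable_at_if_verdict[OF assms(2)]
  have "EPZ_monitorable Act P \<longleftrightarrow>
      (\<exists>m \<in> M. sound_for Act acc rej m P \<and> informative Act acc rej m)"
    unfolding EPZ_monitorable_def informative_def
    using m(1,2) m(3)[of "[]"] mon[where s = "[]"] by (simp; blast)
  moreover have "UPZ_monitorable Act P \<longleftrightarrow>
      (\<exists>m \<in> M. sound_for Act acc rej m P \<and> persistently_informative Act acc rej m)"
    unfolding UPZ_monitorable_def persistently_informative_def
    using m mon by meson
  ultimately show ?thesis
    by blast
qed

end
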